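(* For an index set $\mathcal S\subset\{1,2,3,4\}$ with $|\mathcal S|=3$, there exists a matrix $A\in\mathbb R^{4\times4}$ with unit columns such that $A$ achieves exact vector recovery for the fixed support $\mathcal S$ via orthogonal matching pursuit (OMP), $A_{\bullet\mathcal S}$ has full column rank, and $$\big\|(A_{\bullet\mathcal S}^TA_{\bullet\mathcal S})^{-1}A_{\bullet\mathcal S}^TA_{\bullet\mathcal S^c}\big\|_1=1.$$
   Context: Unit columns means every column of $A$ has Euclidean norm $1$. $A_{\bullet\mathcal S}$ is the submatrix of columns of $A$ indexed by $\mathcal S$; $\mathcal S^c$ is the complement of $\mathcal S$; $\|\cdot\|_1$ is the matrix 1-norm (maximum absolute column sum); $\mathrm{supp}(x)=\{i: x_i\ne0\}$; $\mathbf e_j$ is the $j$th standard basis vector; here $N=4$. OMP with input $y$: $x^0=0$, $\mathcal J_0=\emptyset$; for $k=0,1,\dots$: choose any $j^*_{k+1}\in\{1,\dots,N\}$ minimizing $\min_{t\in\mathbb R}\|y-A(x^k+t\mathbf e_j)\|_2^2$ over $j$ (equivalently maximizing $|A_{\bullet j}^T(y-Ax^k)|$); set $\mathcal J_{k+1}=\mathcal J_k\cup\{j^*_{k+1}\}$; choose any $x^{k+1}$ minimizing $\|Aw-y\|_2^2$ over $w\in\mathbb R^N$ with $\mathrm{supp}(w)\subseteq\mathcal J_{k+1}$. Several sequences may be generated due to non-unique choices. Exact vector recovery of $z$ is achieved from $y=Az$ if along every generated sequence there is an $s$ with $\mathcal J_s=\mathrm{supp}(z)$, and along every sequence, once $\mathcal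 J_s=\mathrm{supp}(z)$ is reached, the minimization problem defining $x^s$ has the unique solution $x^s=z$. Exact vector recovery for the fixed support $\mathcal S$ is achieved if exact vector recovery of every $z\in\mathbb R^N$ with $\mathrm{supp}(z)=\mathcal S$ is achieved. *)

theory Defs
  imports "HOL-Analysis.Analysis"
begin

definition vec_supp :: "real^'n \<Rightarrow> 'n set" where
  "vec_supp x = {i. x $ i \<noteq> 0}"

text \<open>
  The submatrix of \<open>A\<close> consisting of the columns indexed by \<open>S\<close>, in increasing order.
  The column type \<open>'k\<close> of the result is determined by the context and is meaningful only
  if \<open>CARD('k) = card S\<close>: as \<open>card {..<j}\<close> is the position of \<open>j\<close> in \<open>'k\<close>, counted
  from 0, column \<open>j\<close> of the result is the column of \<open>A\<close> whose index has that position in \<open>S\<close>.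
\<close>

definition column_submatrix ::
    "real^'n::{finite,linorder}^'m \<Rightarrow> 'n set \<Rightarrow> real^'k::{finite,linorder}^'m" where
  "column_submatrix A S = (\<chi> i j. A $ i $ (sorted_list_of_set S ! card {..<j}))"

lemma column_submatrix_index:
  fixes S :: "'n::{finite,linorder} set"
  assumes "card S = CARD('k::{finite,linorder})"
  defines "f \<equiv> \<lambda>j::'k. sorted_list_of_set S ! card {..<j}"
  shows "strict_mono f" and "range f = S"
proof -
  have less: "card {..<j} < card S" for j :: 'k
    unfolding assms(1) by (rule psubset_card_mono) auto
  have "card {..<i} < card {..<j}" if "i < j" for i j :: 'k
    using that by (intro psubset_card_mono) auto
  then show mono: "strict_mono f"
    unfolding f_def
    by (intro strict_monoI sorted_wrt_nth_less[where P = "(<)"]) (simp_all add: less)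
  have "f j \<in> S" for j
    using less[of j] nth_mem[of "card {..<j}" "sorted_list_of_set S"] by (simp add: f_def)
  moreover have "card (range f) = card S"
    using mono assms(1) by (simp add: card_image strict_mono_imp_inj_on)
  ultimately show "range f = S"
    by (intro card_subset_eq) auto
qed

definition matrix_norm1 :: "real^'n^'m \<Rightarrow> real" where
  "matrix_norm1 B = (MAX j. \<Sum>i\<in>UNIV. \<bar>B $ i $ j\<bar>)"

definition unit_columns :: "real^'n^'m \<Rightarrow> bool" where
  "unit_columns A \<longleftrightarrow> (\<forall>j. norm (column j A) = 1)"

text \<open>
  The pairs \<open>(x, J)\<close> of sequences that orthogonal matching pursuit may generate from the
  input \<open>y\<close>. Both choices in a step are arbitrary among the minimizers, so there may be several.
  The infimum over \<open>t\<close> is attained, since the objective is a convex quadratic in \<open>t\<close>.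
\<close>

definition omp_sequence ::
    "real^'n^'m \<Rightarrow> real^'m \<Rightarrow> (nat \<Rightarrow> real^'n) \<Rightarrow> (nat \<Rightarrow> 'n set) \<Rightarrow> bool" where
  "omp_sequence A y x J \<longleftrightarrow>
     x 0 = 0 \<and> J 0 = {} \<and>
     (\<forall>k. \<exists>j.
        is_arg_min (\<lambda>i. INF t::real. (norm (y - A *v (x k + t *\<^sub>R axis i 1)))\<^sup>2) (\<lambda>i. True) j \<and>
        J (Suc k) = J k \<union> {j} \<and>
        is_arg_min (\<lambda>w. (norm (A *v w - y))\<^sup>2) (\<lambda>w. vec_supp w \<subseteq> J (Suc k)) (x (Suc k)))"

definition exact_vector_recovery :: "real^'n^'m \<Rightarrow> real^'n \<Rightarrow> bool" where
  "exact_vector_recovery A z \<longleftrightarrow>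
     (\<forall>x J. omp_sequence A (A *v z) x J \<longrightarrow>
        (\<exists>s. J s = vec_supp z) \<and>
        (\<forall>s. J s = vec_supp z \<longrightarrow>
           x s = z \<and>
           (\<forall>w. is_arg_min (\<lambda>w. (norm (A *v w - A *v z))\<^sup>2) (\<lambda>w. vec_supp w \<subseteq> J s) w
                \<longleftrightarrow> w = z)))"

definition exact_vector_recovery_support :: "real^'n^'m \<Rightarrow> 'n set \<Rightarrow> bool" where
  "exact_vector_recovery_support A S \<longleftrightarrow>
     (\<forall>z. vec_supp z = S \<longrightarrow> exact_vector_recovery A z)"

end

theory Submission
  imports Defs
begin

text \<open>
  Choose the columns in \<open>S\<close> with Gram matrix \<open>G\<close> having rows \<open>(1, 0, 1/2)\<close>, \<open>(0, 1, 1/2)\<close>,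
  \<open>(1/2, 1/2, 1)\<close>, and let the fourth column be their average plus a vector orthogonal to all of
  them. The coefficient vector \<open>(1/3, 1/3, 1/3)\<close> then has norm 1. If \<open>u\<close> is the vector of
  correlations of a residual with the columns in \<open>S\<close>, the correlation with the fourth column is
  the average of \<open>u\<close>, so it can compete with the largest entry of \<open>u\<close> only if \<open>u\<close> is constant.
  After the first step \<open>u\<close> vanishes on the indices already chosen, so a constant \<open>u\<close> would be
  zero. In the first step \<open>u = G z\<close>, and this is constant only if \<open>z\<close> is a multiple of
  \<open>(1, 1, 0)\<close>, which does not have full support.
\<close>

section \<open>The two minimizations in a step, for unit columns\<close>

lemma matrix_vector_mult_add_scaleR_axis:
  fixes A :: "real^'n^'m"
  shows "A *v (x + t *\<^sub>R axis i 1) = A *v x + t *\<^sub>R column i A"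
  by (simp add: matrix_vector_right_distrib matrix_vector_mult_scaleR matrix_vector_mult_basis)

text \<open>Completing the square in \<open>t\<close>; the minimum is at
  \<open>t = a \<bullet> r\<close>.\<close>

lemma norm_diff_unit_scaleR:
  fixes r a :: "'a::real_inner"
  assumes "norm a = 1"
  shows "(norm (r - t *\<^sub>R a))\<^sup>2 = (norm r)\<^sup>2 - (a \<bullet> r)\<^sup>2 + (t - a \<bullet> r)\<^sup>2"
proof -
  have "a \<bullet> a = 1"
    using assms by (simp add: dot_square_norm)
  then show ?thesis
    unfolding power2_norm_eq_inner
    by (simp add: algebra_simps inner_commute power2_eq_square)
qed

lemma INF_norm_diff_unit_scaleR:
  fixes r a :: "'a::real_inner"
  assumes "norm a = 1"
  shows "(INF t. (norm (r - t *\<^sub>R a))\<^sup>2) = (norm r)\<^sup>2 - (a \<bullet> r)\<^sup>2"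
proof -
  have "(norm r)\<^sup>2 - (a \<bullet> r)\<^sup>2 = (norm (r - (a \<bullet> r) *\<^sub>R a))\<^sup>2"
    by (simp add: norm_diff_unit_scaleR[OF assms])
  then have "(norm r)\<^sup>2 - (a \<bullet> r)\<^sup>2 \<in> range (\<lambda>t. (norm (r - t *\<^sub>R a))\<^sup>2)"
    by (rule image_eqI) simp
  then show ?thesis
    by (rule cInf_eq_minimum) (auto simp: norm_diff_unit_scaleR[OF assms])
qed

text \<open>Adding the best multiple of column \<open>i\<close> lowers the squared residual by its
  squared correlation with the residual, so a minimizing index has the largest absolute
  correlation.\<close>

lemma omp_choice_maximal:
  fixes A :: "real^'n^'m"
  assumes "unit_columns A"
    and "is_arg_min (\<lambda>i. INF t::real. (norm (y - A *v (x + t *\<^sub>R axis i 1)))\<^sup>2) (\<lambda>i. True) j"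
  shows "\<bar>column i A \<bullet> (y - A *v x)\<bar> \<le> \<bar>column j A \<bullet> (y - A *v x)\<bar>"
proof -
  have "(INF t::real. (norm (y - A *v (x + t *\<^sub>R axis i 1)))\<^sup>2)
      = (norm (y - A *v x))\<^sup>2 - (column i A \<bullet> (y - A *v x))\<^sup>2" for i
    using assms(1) INF_norm_diff_unit_scaleR[of "column i A" "y - A *v x"]
    by (simp add: unit_columns_def matrix_vector_mult_add_scaleR_axis diff_diff_eq)
  then show ?thesis
    using assms(2) by (simp add: is_arg_min_linorder abs_le_square_iff)
qed

text \<open>Otherwise moving \<open>x\<close> along axis \<open>i\<close> by the correlation itself
  would keep the support in \<open>J\<close> and lower the objective by the square of that
  correlation.\<close>

lemma least_squares_residual_orthogonal:
  fixes A :: "real^'n^'m"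
  assumes "unit_columns A"
    and min: "is_arg_min (\<lambda>w. (norm (A *v w - y))\<^sup>2) (\<lambda>w. vec_supp w \<subseteq> J) x"
    and "i \<in> J"
  shows "column i A \<bullet> (y - A *v x) = 0"
proof -
  let ?r = "y - A *v x" and ?t = "column i A \<bullet> (y - A *v x)"
  have "vec_supp (x + ?t *\<^sub>R axis i 1) \<subseteq> J"
    using min \<open>i \<in> J\<close> by (auto simp: is_arg_min_def vec_supp_def axis_def)
  then have "(norm (A *v x - y))\<^sup>2 \<le> (norm (A *v (x + ?t *\<^sub>R axis i 1) - y))\<^sup>2"
    using min by (simp add: is_arg_min_linorder)
  also have "A *v (x + ?t *\<^sub>R axis i 1) - y = - (?r - ?t *\<^sub>R column i A)"
    by (simp add: matrix_vector_mult_add_scaleR_axis)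
  finally have "(norm ?r)\<^sup>2 \<le> (norm (?r - ?t *\<^sub>R column i A))\<^sup>2"
    by (simp only: norm_minus_cancel norm_minus_commute[of "A *v x"])
  also have "\<dots> = (norm ?r)\<^sup>2 - ?t\<^sup>2"
    using norm_diff_unit_scaleR[of "column i A" ?r ?t] assms(1) by (simp add: unit_columns_def)
  finally show ?thesis
    by simp
qed

section \<open>A sufficient criterion for exact recovery\<close>

lemma vec_supp_diff: "vec_supp (x - y) \<subseteq> vec_supp x \<union> vec_supp y"
  by (auto simp: vec_supp_def)

text \<open>\<open>A *v w\<close> is a combination of the columns, hence orthogonal to
  itself.\<close>

lemma orthogonal_columns_imp_zero:
  fixes A :: "real^'n^'m"
  assumes "\<And>i. column i A \<bullet> (A *v w) = 0"
  shows "A *v w = 0"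
proof -
  have "(A *v w) \<bullet> (A *v w) = (\<Sum>i\<in>UNIV. w $ i *\<^sub>R column i A) \<bullet> (A *v w)"
    by (simp add: matrix_mult_sum scalar_mult_eq_scaleR)
  also have "\<dots> = 0"
    by (simp add: inner_sum_left assms)
  finally show ?thesis
    by simp
qed

text \<open>\<open>sel\<close> uses only what the least-squares step guarantees about an iterate:
  its support and the orthogonality of its residual to the chosen columns. Strictness keeps ties
  from leading outside the support. Together with \<open>inj\<close> it makes each of the first
  \<open>card (vec_supp z)\<close> steps add a new index of the support.\<close>

lemma exact_vector_recoveryI:
  fixes A :: "real^'n^'m"
  assumes unit: "unit_columns A"
    and inj: "\<And>w. vec_supp w \<subseteq> vec_supp z \<Longrightarrow> A *v w = 0 \<Longrightarrow> w = 0"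
    and sel: "\<And>J x j. \<lbrakk>J \<subset> vec_supp z; vec_supp x \<subseteq> J;
      \<And>i. i \<in> J \<Longrightarrow> column i A \<bullet> (A *v (z - x)) = 0; j \<notin> vec_supp z\<rbrakk>
      \<Longrightarrow> \<exists>i\<in>vec_supp z. \<bar>column j A \<bullet> (A *v (z - x))\<bar> < \<bar>column i A \<bullet> (A *v (z - x))\<bar>"
  shows "exact_vector_recovery A z"
proof -
  let ?S = "vec_supp z"
  have unique: "is_arg_min (\<lambda>w. (norm (A *v w - A *v z))\<^sup>2) (\<lambda>w. vec_supp w \<subseteq> ?S) w \<longleftrightarrow> w = z"
    for w
  proof
    assume w: "is_arg_min (\<lambda>w. (norm (A *v w - A *v z))\<^sup>2) (\<lambda>w. vec_supp w \<subseteq> ?S) w"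
    then have "(norm (A *v w - A *v z))\<^sup>2 \<le> (norm (A *v z - A *v z))\<^sup>2"
      unfolding is_arg_min_linorder by blast
    then have "A *v (w - z) = 0"
      by (simp add: matrix_vector_mult_diff_distrib)
    moreover have "vec_supp (w - z) \<subseteq> ?S"
      using w vec_supp_diff[of w z] by (auto simp: is_arg_min_def)
    ultimately show "w = z"
      using inj[of "w - z"] by simp
  qed (simp add: is_arg_min_linorder)
  show ?thesis
    unfolding exact_vector_recovery_def
  proof (intro allI impI conjI)
    fix x J assume omp: "omp_sequence A (A *v z) x J"
    have residual: "A *v z - A *v x k = A *v (z - x k)" for k
      by (simp add: matrix_vector_mult_diff_distrib)
    have supp: "vec_supp (x k) \<subseteq> J k" for k
      using omp by (cases k) (auto simp: omp_sequence_def is_arg_min_def vec_supp_def)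
    have orth: "column i A \<bullet> (A *v (z - x k)) = 0" if "i \<in> J k" for i k
    proof (cases k)
      case 0
      then show ?thesis
        using omp that by (simp add: omp_sequence_def)
    next
      case (Suc l)
      then have "is_arg_min (\<lambda>w. (norm (A *v w - A *v z))\<^sup>2) (\<lambda>w. vec_supp w \<subseteq> J k) (x k)"
        using omp by (auto simp: omp_sequence_def)
      from least_squares_residual_orthogonal[OF unit this that] show ?thesis
        by (simp add: residual)
    qed
    have "J k \<subseteq> ?S \<and> card (J k) = k" if "k \<le> card ?S" for k
      using that
    proof (induction k)
      case 0
      then show ?case
        using omp by (simp add: omp_sequence_def)
    next
      case (Suc k)
      then have IH: "J k \<subseteq> ?S" "card (J k) = k" "J k \<noteq> ?S"
        by auto
      obtain j where
        min: "is_arg_min (\<lambda>i. INF t::real. (norm (A *v z - A *v (x k + t *\<^sub>R axis i 1)))\<^sup>2)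
               (\<lambda>i. True) j"
        and J: "J (Suc k) = J k \<union> {j}"
        using omp unfolding omp_sequence_def by blast
      have max: "\<bar>column i A \<bullet> (A *v (z - x k))\<bar> \<le> \<bar>column j A \<bullet> (A *v (z - x k))\<bar>" for i
        using omp_choice_maximal[OF unit min, of i] by (simp add: residual)
      have "j \<in> ?S"
      proof (rule ccontr)
        assume "j \<notin> ?S"
        then obtain i where
          "\<bar>column j A \<bullet> (A *v (z - x k))\<bar> < \<bar>column i A \<bullet> (A *v (z - x k))\<bar>"
          using sel[of "J k" "x k" j] IH supp orth by blast
        with max[of i] show False
          by simp
      qed
      \<comment> \<open>Choosing an old index means that the largest correlation is zero. Then the
        residual vanishes and \<open>x k = z\<close>, although \<open>x k\<close> is supported on a
        proper subset of the support of \<open>z\<close>.\<close>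
      moreover have "j \<notin> J k"
      proof
        assume "j \<in> J k"
        then have "column i A \<bullet> (A *v (z - x k)) = 0" for i
          using max[of i] orth by simp
        then have "A *v (z - x k) = 0"
          using orthogonal_columns_imp_zero[of A "z - x k"] by simp
        moreover have "vec_supp (z - x k) \<subseteq> ?S"
          using vec_supp_diff[of z "x k"] supp[of k] IH(1) by blast
        ultimately have "z - x k = 0"
          by (intro inj)
        then show False
          using supp[of k] IH by auto
      qed
      ultimately show ?case
        using IH J by simp
    qed
    from this[of "card ?S"] have "J (card ?S) = ?S"
      by (intro card_subset_eq) auto
    then show "\<exists>s. J s = ?S"
      by blast
  next
    fix x J s w assume omp: "omp_sequence A (A *v z) x J" and s: "J s = ?S"
    show "x s = z"
    proof (cases s)
      \<comment> \<open>No minimization defines \<open>x 0\<close>; here the support of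
        \<open>z\<close> is empty, so \<open>z = 0 = x 0\<close>.\<close>
      case 0
      then show ?thesis
        using omp s by (simp add: omp_sequence_def vec_supp_def vec_eq_iff)
    next
      case (Suc k)
      then have "is_arg_min (\<lambda>w. (norm (A *v w - A *v z))\<^sup>2) (\<lambda>w. vec_supp w \<subseteq> J s) (x s)"
        using omp by (auto simp: omp_sequence_def)
      then show ?thesis
        using unique s by simp
    qed
    show "is_arg_min (\<lambda>w. (norm (A *v w - A *v z))\<^sup>2) (\<lambda>w. vec_supp w \<subseteq> J s) w \<longleftrightarrow> w = z"
      using unique s by simp
  qed
qed

section \<open>Submatrices, Gram matrices and the pseudoinverse\<close>

lemma sum_column_submatrix:
  fixes A :: "real^'n::{finite,linorder}^'m" and h :: "'n \<Rightarrow> real"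
  assumes "card S = CARD('k::{finite,linorder})"
  shows "(\<Sum>k\<in>UNIV. (column_submatrix A S :: real^'k::{finite,linorder}^'m) $ i $ k
           * h (sorted_list_of_set S ! card {..<k})) = (\<Sum>j\<in>S. A $ i $ j * h j)"
proof -
  let ?f = "\<lambda>k::'k. sorted_list_of_set S ! card {..<k}"
  have "inj ?f" "range ?f = S"
    using column_submatrix_index[OF assms] by (simp_all add: strict_mono_imp_inj_on)
  then show ?thesis
    using sum.reindex[of ?f UNIV "\<lambda>j. A $ i $ j * h j"]
    by (simp add: column_submatrix_def comp_def)
qed

text \<open>Transport \<open>w\<close> to the indices in \<open>S\<close> and extend it by zero;
  this does not change the product.\<close>

lemma column_submatrix_ker:
  fixes A :: "real^'n::{finite,linorder}^'m" and w :: "real^'k::{finite,linorder}"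
  assumes card: "card S = CARD('k)"
    and inj: "\<And>w. vec_supp w \<subseteq> S \<Longrightarrow> A *v w = 0 \<Longrightarrow> w = 0"
    and w: "column_submatrix A S *v w = 0"
  shows "w = 0"
proof -
  let ?f = "\<lambda>k::'k. sorted_list_of_set S ! card {..<k}"
  have f: "inj ?f" "range ?f = S"
    using column_submatrix_index[OF card] by (simp_all add: strict_mono_imp_inj_on)
  define v where "v = (\<chi> j. if j \<in> S then w $ inv ?f j else 0)"
  have v: "v $ ?f k = w $ k" for k
    using f(2) inv_f_f[OF f(1)] by (auto simp: v_def)
  have "(A *v v) $ i = (column_submatrix A S *v w) $ i" for i
  proof -
    have "(A *v v) $ i = (\<Sum>j\<in>S. A $ i $ j * v $ j)"
      unfolding matrix_vector_mult_def vec_lambda_beta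
      by (rule sum.mono_neutral_right) (auto simp: v_def)
    then show ?thesis
      using sum_column_submatrix[OF card, of A i "\<lambda>j. v $ j"]
      by (simp add: v matrix_vector_mult_def)
  qed
  then have "A *v v = 0"
    using w by (simp add: vec_eq_iff)
  moreover have "vec_supp v \<subseteq> S"
    by (auto simp: vec_supp_def v_def)
  ultimately have "v = 0"
    by (rule inj[rotated])
  then show ?thesis
    using v by (simp add: vec_eq_iff)
qed

lemma invertible_gram:
  fixes B :: "real^'k^'m"
  assumes "\<And>w. B *v w = 0 \<Longrightarrow> w = 0"
  shows "invertible (transpose B ** B)"
  unfolding invertible_left_inverse matrix_left_invertible_ker
proof (intro allI impI)
  fix w assume "(transpose B ** B) *v w = 0"
  then have "(B *v w) \<bullet> (B *v w) = 0"
    by (simp add: dot_lmul_matrix[symmetric] vector_transpose_matrix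
        matrix_vector_mul_assoc[symmetric] inner_commute flip: transpose_matrix_vector)
  then show "w = 0"
    using assms by simp
qed

text \<open>Verifying the normal equations for a guessed \<open>V\<close> avoids computing the
  inverse.\<close>

lemma pseudoinverse_mult_eq:
  fixes B :: "real^'k^'m" and C :: "real^'l^'m"
  assumes "\<And>w. B *v w = 0 \<Longrightarrow> w = 0"
    and "transpose B ** C = transpose B ** (B ** V)"
  shows "matrix_inv (transpose B ** B) ** transpose B ** C = V"
proof -
  have "matrix_inv (transpose B ** B) ** transpose B ** C
      = matrix_inv (transpose B ** B) ** (transpose B ** B) ** V"
    using assms(2) by (simp add: matrix_mul_assoc[symmetric])
  also have "matrix_inv (transpose B ** B) ** (transpose B ** B) = mat 1"
    using someI_ex[OF invertible_gram[OF assms(1), unfolded invertible_def]]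
    unfolding matrix_inv_def by blast
  finally show ?thesis
    by simp
qed

section \<open>The matrix and its verification\<close>

theorem theorem5p2:
  fixes S :: "4 set"
  assumes "card S = 3"
  shows "\<exists>A :: real^4^4.
    unit_columns A \<and>
    exact_vector_recovery_support A S \<and>
    rank (column_submatrix A S :: real^3^4) = 3 \<and>
    (let B = (column_submatrix A S :: real^3^4);
         C = (column_submatrix A (- S) :: real^1^4)
     in matrix_norm1 (matrix_inv (transpose B ** B) ** transpose B ** C) = 1)"
proof -
  obtain a b c where S: "S = {a, b, c}" and distinct: "a \<noteq> b" "a \<noteq> c" "b \<noteq> c"
    using assms by (auto simp: card_3_iff)
  have "card (- S) = 1"
    using assms by (simp add: Compl_eq_Diff_UNIV card_Diff_subset)
  then obtain p where p: "- S = {p}"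
    by (rule card_1_singletonE)
  then have p_notin: "p \<noteq> a" "p \<noteq> b" "p \<noteq> c"
    using S by auto
  have "UNIV = S \<union> - S"
    by simp
  also have "\<dots> = {a, b, c, p}"
    unfolding p by (auto simp: S)
  finally have UNIV: "UNIV = {a, b, c, p}" .
  note neq = distinct distinct[symmetric] p_notin p_notin[symmetric]
  have all: "(\<forall>i. P i) \<longleftrightarrow> P a \<and> P b \<and> P c \<and> P p" for P
    using UNIV by (metis UNIV_I insertE singletonD)
  have sum: "sum h UNIV = h a + h b + h c + h p" for h :: "4 \<Rightarrow> real"
    unfolding UNIV using neq by simp
  \<comment> \<open>The indices also name the coordinates. The default value is column
    \<open>p\<close>: the first three terms are the average of the other columns, of squared norm
    5/9, and 2/3 along axis \<open>p\<close> completes it to a unit vector. Likewise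
    \<open>sqrt 2 / 2\<close> makes column \<open>c\<close> a unit vector.\<close>
  define col :: "4 \<Rightarrow> real^4" where
    "col = (\<lambda>_. (1/2) *\<^sub>R axis a 1 + (1/2) *\<^sub>R axis b 1
                  + (sqrt 2 / 6) *\<^sub>R axis c 1 + (2/3) *\<^sub>R axis p 1)
      (a := axis a 1, b := axis b 1,
       c := (1/2) *\<^sub>R axis a 1 + (1/2) *\<^sub>R axis b 1 + (sqrt 2 / 2) *\<^sub>R axis c 1)"
  define A :: "real^4^4" where "A = (\<chi> i j. col j $ i)"
  have column: "column j A = col j" for j
    by (simp add: column_def A_def vec_eq_iff)
  have entries:
    "col a $ a = 1" "col a $ b = 0" "col a $ c = 0" "col a $ p = 0"
    "col b $ a = 0" "col b $ b = 1" "col b $ c = 0" "col b $ p = 0"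
    "col c $ a = 1/2" "col c $ b = 1/2" "col c $ c = sqrt 2 / 2" "col c $ p = 0"
    "col p $ a = 1/2" "col p $ b = 1/2" "col p $ c = sqrt 2 / 6" "col p $ p = 2/3"
    using neq by (simp_all add: col_def axis_def)
  have unit: "unit_columns A"
    unfolding unit_columns_def column all norm_eq_1 inner_vec_def sum
    by (simp add: entries)
  have mult: "(A *v w) $ i = col a $ i * w $ a + col b $ i * w $ b + col c $ i * w $ c"
    if "vec_supp w \<subseteq> S" for w i
  proof -
    have "w $ p = 0"
      using that p by (auto simp: vec_supp_def)
    then show ?thesis
      by (simp add: matrix_vector_mult_def sum A_def)
  qed
  have inj: "w = 0" if "vec_supp w \<subseteq> S" "A *v w = 0" for w
  proof -
    have "w $ p = 0"
      using that(1) p by (auto simp: vec_supp_def)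
    then show ?thesis
      using that(2) mult[OF that(1), of a] mult[OF that(1), of b] mult[OF that(1), of c]
      by (simp add: vec_eq_iff all entries)
  qed
  have recovery: "exact_vector_recovery A z" if z: "vec_supp z = S" for z
  proof (rule exact_vector_recoveryI[OF unit])
    show "w = 0" if "vec_supp w \<subseteq> vec_supp z" "A *v w = 0" for w
      using inj that z by simp
  next
    fix J x j
    assume J: "J \<subset> vec_supp z" and x: "vec_supp x \<subseteq> J"
      and orth: "\<And>i. i \<in> J \<Longrightarrow> column i A \<bullet> (A *v (z - x)) = 0"
      and "j \<notin> vec_supp z"
    then have j: "j = p"
      using p z by auto
    define w where "w = z - x"
    define u where "u = (\<lambda>i. col i \<bullet> (A *v w))"
    \<comment> \<open>Hence \<open>A *v w\<close> has no \<open>p\<close> coordinate, and its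
      product with column \<open>p\<close> is the average of the other three products.\<close>
    have w: "vec_supp w \<subseteq> S"
      using vec_supp_diff[of z x] J x z unfolding w_def by blast
    have u: "u a = w $ a + w $ c / 2" "u b = w $ b + w $ c / 2" "u c = w $ a / 2 + w $ b / 2 + w $ c"
      "u p = (u a + u b + u c) / 3"
      by (simp_all add: u_def inner_vec_def sum mult[OF w] entries field_simps)
    show "\<exists>i\<in>vec_supp z. \<bar>column j A \<bullet> (A *v (z - x))\<bar> < \<bar>column i A \<bullet> (A *v (z - x))\<bar>"
    proof (rule ccontr)
      assume "\<not> ?thesis"
      then have "\<bar>u a\<bar> \<le> \<bar>u p\<bar>" "\<bar>u b\<bar> \<le> \<bar>u p\<bar>" "\<bar>u c\<bar> \<le> \<bar>u p\<bar>"
        by (auto simp: j z S column u_def w_def not_less)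
      \<comment> \<open>Depending on the sign of \<open>u p\<close>, all three values lie on the
        same side of it. As it is their average, they are all equal to it.\<close>
      then have "u a \<le> u p \<and> u b \<le> u p \<and> u c \<le> u p \<or> u p \<le> u a \<and> u p \<le> u b \<and> u p \<le> u c"
        unfolding abs_le_iff by linarith
      moreover have "u a + u b + u c = 3 * u p"
        using u(4) by simp
      ultimately have eq: "u a = u c" "u b = u c"
        by auto
      then have "w $ c = 0" "w $ a = u c" "w $ b = u c"
        using u by auto
      show False
      proof (cases "J = {}")
        case True
        then have "x = 0"
          using x by (auto simp: vec_supp_def vec_eq_iff)
        then show False
          using \<open>w $ c = 0\<close> z S by (auto simp: w_def vec_supp_def)
      next
        case False
        then obtain i where "i \<in> J"
          by blast
        moreover have "i \<in> {a, b, c}"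
          using calculation J z S by blast
        ultimately have "u c = 0"
          using orth[of i] eq by (auto simp: u_def w_def column)
        then have "\<forall>i\<in>S. z $ i = x $ i"
          using \<open>w $ c = 0\<close> \<open>w $ a = u c\<close> \<open>w $ b = u c\<close> by (simp add: S w_def)
        then have "vec_supp z \<subseteq> vec_supp x"
          using z by (auto simp: vec_supp_def)
        then show False
          using J x by blast
      qed
    qed
  qed
  define B where "B = (column_submatrix A S :: real^3^4)"
  define C where "C = (column_submatrix A (- S) :: real^1^4)"
  \<comment> \<open>The coefficients of the average of the three columns; their sum is the required
    norm.\<close>
  define V :: "real^1^3" where "V = (\<chi> i j. 1/3)"
  have card: "card S = CARD(3)"
    using assms by simp
  have ker: "w = 0" if "B *v w = 0" for w
    using column_submatrix_ker[OF card inj] that by (simp add: B_def)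
  have "rank B = 3"
  proof -
    have "inj ((*v) B)"
      using ker by (simp add: linear_injective_0 matrix_vector_mul_linear)
    then show ?thesis
      using full_rank_injective[of B] by simp
  qed
  have "matrix_inv (transpose B ** B) ** transpose B ** C = V"
  proof (rule pseudoinverse_mult_eq[OF ker])
    have BV: "(B ** V) $ i $ l = (col a $ i + col b $ i + col c $ i) / 3" for i l
      using sum_column_submatrix[OF card, of A i "\<lambda>_. 1/3"] neq
      by (simp add: matrix_matrix_mult_def V_def B_def S A_def field_simps)
    have C: "C $ i $ l = col p $ i" for i l
    proof -
      have "range (\<lambda>l::1. sorted_list_of_set (- S) ! card {..<l}) = - S"
        by (rule column_submatrix_index(2)) (simp add: p)
      then have "sorted_list_of_set (- S) ! card {..<l} = p"
        unfolding p by blast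
      then show ?thesis
        by (simp add: C_def column_submatrix_def A_def)
    qed
    have B: "\<exists>j\<in>S. \<forall>i. B $ i $ k = col j $ i" for k
    proof
      show "sorted_list_of_set S ! card {..<k} \<in> S"
        using column_submatrix_index(2)[OF card] by blast
    qed (simp add: B_def column_submatrix_def A_def)
    \<comment> \<open>\<open>C\<close> and \<open>B ** V\<close> differ only in row
      \<open>p\<close>, where every column in \<open>S\<close> is zero.\<close>
    have "(transpose B ** C) $ k $ l = (transpose B ** (B ** V)) $ k $ l" for k l
    proof -
      obtain j where j: "j \<in> S" "\<And>i. B $ i $ k = col j $ i"
        using B by blast
      have "(transpose B ** M) $ k $ l = (\<Sum>i\<in>UNIV. col j $ i * M $ i $ l)" for M :: "real^1^4"
        by (simp add: matrix_matrix_mult_def transpose_def j(2))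
      then show ?thesis
        using j(1) unfolding S by (auto simp: sum BV C entries)
    qed
    then show "transpose B ** C = transpose B ** (B ** V)"
      by (simp add: vec_eq_iff)
  qed
  moreover have "matrix_norm1 V = 1"
    by (simp add: matrix_norm1_def V_def)
  ultimately have "let B = (column_submatrix A S :: real^3^4);
         C = (column_submatrix A (- S) :: real^1^4)
     in matrix_norm1 (matrix_inv (transpose B ** B) ** transpose B ** C) = 1"
    unfolding Let_def B_def C_def by simp
  moreover have "exact_vector_recovery_support A S"
    using recovery unfolding exact_vector_recovery_support_def by blast
  ultimately show ?thesis
    using unit \<open>rank B = 3\<close> unfolding B_def by blast
qed

end
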